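(* Let $Y$ and $E$ be normed spaces and let $X$ be a (nonempty) convex subset of $Y$. For each $n\ge 1$ let $L_n\colon D(L_n)\to\mathcal F(X;E)$ be a linear operator dominated by a positive linear operator $S_n\colon D(S_n)\to\mathcal F(X)$. Suppose that for every $n\ge1$ one has $UCB(X;E)\subset D(L_n)$, $UCB(X)\subset D(S_n)$, and $\psi_t^2\in D(S_n)$ for some (and hence for all) $t\in Y$. Put $\gamma_n^2(t):=S_n(\psi_t^2)(t)$, $\gamma_n(t)\ge 0$, for $t\in X$. Then for every $n\ge 1$, $F\in UCB(X;E)$, $t\in X$ and $\delta>0$, $$\|L_n(F)(t)-F(t)\|\le\|L_n(F(t))(t)-F(t)\|+S_n(\|F-F(t)\|)(t)$$ $$\le\|L_n(F(t))(t)-F(t)\|+\omega(F,\delta)\left[S_n(\mathbf 1)(t)+\delta^{-2}\gamma_n^2(t)\right],$$ where $F(t)$, when it appears as an argument of $L_n$ or in $F-F(t)$, denotes the constant mapping on $X$ with value $F(t)$. Moreover, if $L_n$ preserves the constants, then $$\|L_n(F)(t)-F(t)\|\le\omega(F,\delta)\left[S_n(\mathbf 1)(t)+\delta^{-2}\gamma_n^2(t)\right].$$ In particular (taking $\delta=\gamma_n(t)$), $$\|L_n(F)(t)-F(t)\|\le\omega(F,\gamma_n(t))\left[S_n(\mathbf 1)(t)+1\right],$$ and if $\gamma_n$ and $S_n(\mathbf 1)$ are bounded on a subset $K\subset X$, then $$\|L_n(F)-F\|_K\le\omega(F,\|\gamma_n\|_K)\left[\|S_n(\mathbf 1)\|_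K+1\right].$$
   Context: Normed spaces are real or complex. $\mathcal F(X;E)$ is the vector space of all mappings $X\to E$; $\mathcal C(X;E)$ its subspace of continuous mappings; $UCB(X;E)$ the subspace of bounded uniformly continuous mappings. For $E=\mathbb R$ write $\mathcal F(X),\mathcal C(X),UCB(X)$. For $F\in\mathcal F(X;E)$, $\|F\|\colon X\to\mathbb R$ denotes the function $u\mapsto\|F(u)\|$. For $K\subset X$ and a mapping $F$ bounded on $K$, $\|F\|_K:=\sup_{u\in K}\|F(u)\|$. $\mathbf 1$ is the constant function $1$ on $X$; for $c\in E$, the constant mapping with value $c$ is again denoted $c$. For $t\in Y$, $\psi_t\colon X\to\mathbb R$ is $\psi_t(u):=\|u-t\|$. Operators: $D(L)$ and $D(S)$ are linear subspaces of $\mathcal C(X;E)$ and $\mathcal C(X)$ respectively, and $L\colon D(L)\to\mathcal F(X;E)$, $S\colon D(S)\to\mathcal F(X)$ are linear. $S$ is positive if $f\in D(S)$, $f\ge0$ imply $S(f)\ge 0$. $L$ is dominated by $S$ if for all $F\in D(L)$ one has $\|F\|\in D(S)$ and $\|L(F)(t)\|\le S(\|F\|)(t)$ for all $t\in X$. $L$ preserves the constants if for all $c\in E$ one has $c\in D(L)$ and $L(c)(t)=c$ for all $t\in X$. Modulus of continuity: for $F\in UCB(X;E)$ and $h\ge 0$, $\omega(F,h):=\sup\{\|F(u)-F(t)\| : t,u\in X,\ \|t-u\|\le h\}$ (so $\omega(F,0)=0$).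
   Formalization: The condition ψ_t² ∈ D(S_n) is assumed for all t ∈ Y, not just for some t: "hence for all" fails, e.g. for X=Y=ℝ, D(S_n)=UCB(ℝ)+ℝψ_0², S_n=0, D(L_n)=UCB(ℝ;E), L_n=0, where ψ_1² ∉ D(S_n) and γ_n(1) is undefined. *)

theory Defs
  imports "HOL-Analysis.Analysis"
begin

(* A mapping from X to E is an element of X \<rightarrow>\<^sub>E UNIV, so that mappings agreeing on X are equal;
   pointwise operations are accordingly restricted to X.
   Only real scalars occur: a complex normed space is in particular a real one, and complex
   subspaces and complex-linear operators are in particular real ones. *)

definition continuous_maps :: "'a::topological_space set \<Rightarrow> ('a \<Rightarrow> 'b::topological_space) set" where
  "continuous_maps X = {F \<in> X \<rightarrow>\<^sub>E UNIV. continuous_on X F}"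

definition UCB :: "'a::metric_space set \<Rightarrow> ('a \<Rightarrow> 'b::metric_space) set" where
  "UCB X = {F \<in> X \<rightarrow>\<^sub>E UNIV. bounded (F ` X) \<and> uniformly_continuous_on X F}"

definition map_subspace :: "'a set \<Rightarrow> ('a \<Rightarrow> 'b::real_vector) set \<Rightarrow> bool" where
  "map_subspace X D \<longleftrightarrow>
     D \<subseteq> X \<rightarrow>\<^sub>E UNIV \<and>
     (\<lambda>u\<in>X. 0) \<in> D \<and>
     (\<forall>F\<in>D. \<forall>G\<in>D. (\<lambda>u\<in>X. F u + G u) \<in> D) \<and>
     (\<forall>c. \<forall>F\<in>D. (\<lambda>u\<in>X. c *\<^sub>R F u) \<in> D)"

(* L is only meaningful on its domain D. *)
definition linear_operator ::
    "'a::topological_space set \<Rightarrow> ('a \<Rightarrow> 'b::real_normed_vector) set \<Rightarrow>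
     (('a \<Rightarrow> 'b) \<Rightarrow> ('a \<Rightarrow> 'b)) \<Rightarrow> bool" where
  "linear_operator X D L \<longleftrightarrow>
     map_subspace X D \<and> D \<subseteq> continuous_maps X \<and>
     L \<in> D \<rightarrow> (X \<rightarrow>\<^sub>E UNIV) \<and>
     (\<forall>F\<in>D. \<forall>G\<in>D. L (\<lambda>u\<in>X. F u + G u) = (\<lambda>t\<in>X. L F t + L G t)) \<and>
     (\<forall>c. \<forall>F\<in>D. L (\<lambda>u\<in>X. c *\<^sub>R F u) = (\<lambda>t\<in>X. c *\<^sub>R L F t))"

definition positive_operator ::
    "'a set \<Rightarrow> ('a \<Rightarrow> real) set \<Rightarrow> (('a \<Rightarrow> real) \<Rightarrow> ('a \<Rightarrow> real)) \<Rightarrow> bool" where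
  "positive_operator X D S \<longleftrightarrow>
     (\<forall>f\<in>D. (\<forall>u\<in>X. 0 \<le> f u) \<longrightarrow> (\<forall>t\<in>X. 0 \<le> S f t))"

definition dominated_by ::
    "'a set \<Rightarrow> ('a \<Rightarrow> 'b::real_normed_vector) set \<Rightarrow> (('a \<Rightarrow> 'b) \<Rightarrow> ('a \<Rightarrow> 'b)) \<Rightarrow>
     ('a \<Rightarrow> real) set \<Rightarrow> (('a \<Rightarrow> real) \<Rightarrow> ('a \<Rightarrow> real)) \<Rightarrow> bool" where
  "dominated_by X D L D' S \<longleftrightarrow>
     (\<forall>F\<in>D. (\<lambda>u\<in>X. norm (F u)) \<in> D' \<and>
            (\<forall>t\<in>X. norm (L F t) \<le> S (\<lambda>u\<in>X. norm (F u)) t))"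

definition preserves_constants ::
    "'a set \<Rightarrow> ('a \<Rightarrow> 'b) set \<Rightarrow> (('a \<Rightarrow> 'b) \<Rightarrow> ('a \<Rightarrow> 'b)) \<Rightarrow> bool" where
  "preserves_constants X D L \<longleftrightarrow>
     (\<forall>c. (\<lambda>u\<in>X. c) \<in> D \<and> (\<forall>t\<in>X. L (\<lambda>u\<in>X. c) t = c))"

definition psi :: "'a::real_normed_vector set \<Rightarrow> 'a \<Rightarrow> 'a \<Rightarrow> real" where
  "psi X t = (\<lambda>u\<in>X. norm (u - t))"

(* The argument of sqrt is nonnegative whenever S is positive, psi X t squared belongs to
   its domain and t is in X. *)
definition gam :: "'a::real_normed_vector set \<Rightarrow> (('a \<Rightarrow> real) \<Rightarrow> ('a \<Rightarrow> real)) \<Rightarrow> 'a \<Rightarrow> real" where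
  "gam X S t = sqrt (S (\<lambda>u\<in>X. (psi X t u)\<^sup>2) t)"

(* A genuine supremum for nonempty X, F bounded on X and h \<ge> 0. *)
definition modulus ::
    "'a::real_normed_vector set \<Rightarrow> ('a \<Rightarrow> 'b::real_normed_vector) \<Rightarrow> real \<Rightarrow> real" where
  "modulus X F h = Sup {norm (F u - F t) | t u. t \<in> X \<and> u \<in> X \<and> norm (t - u) \<le> h}"

(* Meaningful for F bounded on K. The supremum over the empty set is taken in [0, \<infinity>), hence is 0. *)
definition sup_norm_on :: "'a set \<Rightarrow> ('a \<Rightarrow> 'b::real_normed_vector) \<Rightarrow> real" where
  "sup_norm_on K F = (if K = {} then 0 else (SUP u\<in>K. norm (F u)))"

end

theory Submission
  imports Defs
begin

text \<open>Cutting the segment from \<open>t\<close> to \<open>u\<close>, which lies in the convex set \<open>X\<close>, into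
  \<open>\<lceil>\<parallel>u - t\<parallel>/\<delta>\<rceil>\<close> pieces of length at most \<open>\<delta>\<close> gives
  \<open>\<parallel>F u - F t\<parallel> \<le> \<omega>(F,\<delta>) (1 + \<parallel>u - t\<parallel>\<^sup>2/\<delta>\<^sup>2)\<close>. The positive operator \<open>S\<close>, evaluated at \<open>t\<close>, preserves this
  inequality, and \<open>S \<parallel>F - F(t)\<parallel>\<close> dominates \<open>L (F - F(t))\<close>. If \<open>\<gamma>(t) = 0\<close>, the choice
  \<open>\<delta> = \<gamma>(t)\<close> is not allowed, but then \<open>\<delta> \<rightarrow> 0\<close> is harmless and \<open>\<omega>(F,\<delta>) \<rightarrow> 0\<close> by uniform
  continuity.\<close>

section \<open>Modulus of continuity of a bounded uniformly continuous mapping\<close>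

lemma bdd_above_modulus_set:
  fixes F :: "'a::real_normed_vector \<Rightarrow> 'b::real_normed_vector"
  assumes "F \<in> UCB X"
  shows "bdd_above {norm (F u - F t) | t u. t \<in> X \<and> u \<in> X \<and> norm (t - u) \<le> h}"
proof -
  obtain B where B: "\<And>x. x \<in> X \<Longrightarrow> norm (F x) \<le> B"
    using assms unfolding UCB_def bounded_iff by auto
  show ?thesis
  proof (rule bdd_aboveI)
    fix x assume "x \<in> {norm (F u - F t) | t u. t \<in> X \<and> u \<in> X \<and> norm (t - u) \<le> h}"
    then obtain t u where tu: "t \<in> X" "u \<in> X" "x = norm (F u - F t)"
      by blast
    have "norm (F u - F t) \<le> norm (F u) + norm (F t)"
      by (rule norm_triangle_ineq4)
    then show "x \<le> B + B"
      using B[OF tu(1)] B[OF tu(2)] tu(3) by linarith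
  qed
qed

lemma norm_diff_le_modulus:
  fixes F :: "'a::real_normed_vector \<Rightarrow> 'b::real_normed_vector"
  assumes "F \<in> UCB X" "t \<in> X" "u \<in> X" "norm (u - t) \<le> h"
  shows "norm (F u - F t) \<le> modulus X F h"
  unfolding modulus_def
  using assms by (intro cSup_upper bdd_above_modulus_set) (auto simp: norm_minus_commute)

lemma modulus_least:
  fixes F :: "'a::real_normed_vector \<Rightarrow> 'b::real_normed_vector"
  assumes "X \<noteq> {}" "0 \<le> h"
    and "\<And>t u. t \<in> X \<Longrightarrow> u \<in> X \<Longrightarrow> norm (u - t) \<le> h \<Longrightarrow> norm (F u - F t) \<le> c"
  shows "modulus X F h \<le> c"
  unfolding modulus_def
proof (rule cSup_least)
  \<comment> \<open>\<open>Sup\<close> of the empty set of reals says nothing, so a pair is needed;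
    since \<open>0 \<le> h\<close>, the diagonal pair \<open>x\<close>, \<open>x\<close>
    qualifies.\<close>
  obtain x where "x \<in> X" using assms(1) by blast
  then have "norm (F x - F x) \<in> {norm (F u - F t) | t u. t \<in> X \<and> u \<in> X \<and> norm (t - u) \<le> h}"
    using assms(2) by force
  then show "{norm (F u - F t) | t u. t \<in> X \<and> u \<in> X \<and> norm (t - u) \<le> h} \<noteq> {}"
    by blast
qed (use assms(3) in \<open>auto simp: norm_minus_commute\<close>)

lemma modulus_nonneg:
  fixes F :: "'a::real_normed_vector \<Rightarrow> 'b::real_normed_vector"
  assumes "X \<noteq> {}" "F \<in> UCB X" "0 \<le> h"
  shows "0 \<le> modulus X F h"
proof -
  obtain x where "x \<in> X" using assms(1) by blast
  then show ?thesis
    using norm_diff_le_modulus[OF assms(2), of x x h] assms(3) by simp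
qed

lemma modulus_0:
  fixes F :: "'a::real_normed_vector \<Rightarrow> 'b::real_normed_vector"
  assumes "X \<noteq> {}" "F \<in> UCB X"
  shows "modulus X F 0 = 0"
proof (rule antisym)
  show "modulus X F 0 \<le> 0"
    using assms(1) by (rule modulus_least) auto
qed (simp add: modulus_nonneg[OF assms])

lemma modulus_mono:
  fixes F :: "'a::real_normed_vector \<Rightarrow> 'b::real_normed_vector"
  assumes "X \<noteq> {}" "F \<in> UCB X" "0 \<le> h" "h \<le> k"
  shows "modulus X F h \<le> modulus X F k"
  using assms by (intro modulus_least norm_diff_le_modulus) auto

text \<open>Uniform continuity, restated for the modulus. This is what allows the step to shrink to
  0 at points where \<open>gam\<close> vanishes.\<close>

lemma modulus_arbitrarily_small:
  fixes F :: "'a::real_normed_vector \<Rightarrow> 'b::real_normed_vector"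
  assumes "X \<noteq> {}" "F \<in> UCB X" "0 < e"
  shows "\<exists>h>0. modulus X F h \<le> e"
proof -
  obtain d where d: "d > 0"
    "\<And>x y. x \<in> X \<Longrightarrow> y \<in> X \<Longrightarrow> dist y x < d \<Longrightarrow> dist (F y) (F x) < e"
    using assms(2,3) unfolding UCB_def uniformly_continuous_on_def by blast
  \<comment> \<open>Half of \<open>d\<close>, because the modulus admits distances equal to the
    step, whereas uniform continuity is applied with a strict inequality.\<close>
  have "modulus X F (d / 2) \<le> e"
  proof (rule modulus_least[OF assms(1)])
    fix t u assume "t \<in> X" "u \<in> X" "norm (u - t) \<le> d / 2"
    then have "dist (F u) (F t) < e"
      using d(1) by (intro d(2)) (auto simp: dist_norm)
    then show "norm (F u - F t) \<le> e"
      by (simp add: dist_norm)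
  qed (use d(1) in simp)
  then show ?thesis
    using d(1) by (intro exI[of _ "d / 2"]) simp
qed

text \<open>Convexity keeps the division points of the segment in \<open>X\<close>. The induction
  splits off the piece next to \<open>u\<close>, and each of the \<open>m\<close> pieces costs one
  modulus.\<close>

lemma norm_diff_le_multiple_modulus:
  fixes F :: "'a::real_normed_vector \<Rightarrow> 'b::real_normed_vector"
  assumes "convex X" "F \<in> UCB X" "t \<in> X" "u \<in> X" "norm (u - t) \<le> real m * h"
  shows "norm (F u - F t) \<le> real m * modulus X F h"
  using assms(4,5)
proof (induction m arbitrary: u)
  case 0
  then show ?case by simp
next
  case (Suc m)
  \<comment> \<open>This ratio puts the division point \<open>w\<close> within
    \<open>real m * h\<close> of \<open>t\<close>, as the induction hypothesis requires, and within
    \<open>h\<close> of \<open>u\<close>.\<close>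
  define r where "r = real m / real (Suc m)"
  have r: "0 \<le> r" "r \<le> 1" "1 - r = 1 / real (Suc m)"
    by (auto simp: r_def field_simps)
  define w where "w = (1 - r) *\<^sub>R t + r *\<^sub>R u"
  have w: "w \<in> X"
    unfolding w_def using assms(1,3) Suc.prems(1) r by (intro convexD) auto
  have wt: "w - t = r *\<^sub>R (u - t)" and uw: "u - w = (1 - r) *\<^sub>R (u - t)"
    by (simp_all add: w_def algebra_simps)
  have "norm (w - t) \<le> r * (real (Suc m) * h)"
    unfolding wt using r(1) Suc.prems(2) by (simp add: mult_left_mono del: of_nat_Suc)
  also have "\<dots> = real m * h"
    by (simp add: r_def)
  finally have 1: "norm (F w - F t) \<le> real m * modulus X F h"
    by (rule Suc.IH[OF w])
  have "norm (u - w) \<le> (1 - r) * (real (Suc m) * h)"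
    unfolding uw using r(1,2) Suc.prems(2) by (simp add: mult_left_mono del: of_nat_Suc)
  also have "\<dots> = h"
    unfolding r(3) by simp
  finally have 2: "norm (F u - F w) \<le> modulus X F h"
    by (rule norm_diff_le_modulus[OF assms(2) w Suc.prems(1)])
  have "norm (F u - F t) \<le> norm (F u - F w) + norm (F w - F t)"
    using norm_triangle_ineq[of "F u - F w" "F w - F t"] by simp
  also have "\<dots> \<le> real (Suc m) * modulus X F h"
    using 1 2 by (simp add: algebra_simps)
  finally show ?case .
qed

text \<open>The number of pieces is bounded by a combination of 1 and the squared distance because
  these are the functions whose images under \<open>S\<close> enter the final estimate.\<close>

lemma norm_diff_le_modulus_quadratic:
  fixes F :: "'a::real_normed_vector \<Rightarrow> 'b::real_normed_vector"
  assumes "convex X" "F \<in> UCB X" "t \<in> X" "u \<in> X" "0 < h"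
  shows "norm (F u - F t) \<le> modulus X F h * (1 + (norm (u - t))\<^sup>2 / h\<^sup>2)"
proof -
  define l where "l = norm (u - t) / h"
  have l: "0 \<le> l" "norm (u - t) = l * h"
    using assms(5) by (auto simp: l_def)
  have w: "0 \<le> modulus X F h"
    using assms by (intro modulus_nonneg) auto
  \<comment> \<open>The ceiling of \<open>l\<close> is at most \<open>l + 1\<close>, and
    \<open>l\<close> is at most its square only from 1 on; for smaller \<open>l\<close> a single
    piece suffices.\<close>
  obtain m :: nat where m: "l \<le> real m" "real m \<le> 1 + l\<^sup>2"
  proof (cases "l \<le> 1")
    case True
    then show ?thesis
      using that[of 1] by simp
  next
    case False
    then have "l \<le> l\<^sup>2"
      by (simp add: power2_eq_square)
    moreover have "l \<le> real (nat \<lceil>l\<rceil>)" "real (nat \<lceil>l\<rceil>) \<le> l + 1"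
      using l(1) by linarith+
    ultimately show ?thesis
      using that[of "nat \<lceil>l\<rceil>"] by linarith
  qed
  have "norm (u - t) \<le> real m * h"
    using m(1) assms(5) l(2) by simp
  then have "norm (F u - F t) \<le> real m * modulus X F h"
    by (rule norm_diff_le_multiple_modulus[OF assms(1-4)])
  also have "\<dots> \<le> (1 + l\<^sup>2) * modulus X F h"
    using m(2) w by (rule mult_right_mono)
  finally show ?thesis
    by (simp add: l_def power_divide mult.commute)
qed

section \<open>Constants and translates in \<open>UCB X\<close>, and operator inequalities at a
  point\<close>

lemma const_in_UCB: "(\<lambda>u\<in>X. c) \<in> UCB X"
proof -
  have "(\<lambda>u\<in>X. c) ` X \<subseteq> {c}"
    by auto
  then have "bounded ((\<lambda>u\<in>X. c) ` X)"
    using finite_imp_bounded finite_subset by (metis finite.emptyI finite.insertI)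
  then show ?thesis
    unfolding UCB_def uniformly_continuous_on_def by (auto intro: exI[of _ 1])
qed

lemma diff_const_in_UCB:
  fixes F :: "'a::metric_space \<Rightarrow> 'b::real_normed_vector"
  assumes "F \<in> UCB X"
  shows "(\<lambda>u\<in>X. F u - c) \<in> UCB X"
proof -
  have "(\<lambda>u\<in>X. F u - c) ` X = (\<lambda>x. x - c) ` F ` X"
    by auto
  moreover have "bounded ((\<lambda>x. x - c) ` F ` X)"
    using assms unfolding UCB_def by (intro bounded_translation_minus) blast
  ultimately show ?thesis
    using assms unfolding UCB_def uniformly_continuous_on_def by (simp add: dist_norm)
qed

text \<open>Positivity is applied to the difference of \<open>g\<close> and \<open>f\<close>, formed
  as \<open>g\<close> plus \<open>-1\<close> times \<open>f\<close> because linearity is stated for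
  sums and scalar multiples.\<close>

lemma positive_operator_mono:
  assumes lin: "linear_operator X D S" and pos: "positive_operator X D S"
    and f: "f \<in> D" and g: "g \<in> D" and le: "\<And>u. u \<in> X \<Longrightarrow> f u \<le> g u" and t: "t \<in> X"
  shows "S f t \<le> S g t"
proof -
  define f' where "f' = (\<lambda>u\<in>X. (-1) *\<^sub>R f u)"
  have f': "f' \<in> D" "(\<lambda>u\<in>X. g u + f' u) \<in> D"
    using lin f g unfolding linear_operator_def map_subspace_def f'_def by blast+
  have "S (\<lambda>u\<in>X. g u + f' u) = (\<lambda>t\<in>X. S g t + S f' t)"
    and "S f' = (\<lambda>t\<in>X. (-1) *\<^sub>R S f t)"
    using lin g f f'(1) unfolding linear_operator_def f'_def by blast+
  moreover have "0 \<le> S (\<lambda>u\<in>X. g u + f' u) t"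
    using pos f'(2) le t unfolding positive_operator_def by (simp add: f'_def)
  ultimately show ?thesis
    using t by simp
qed

text \<open>Split \<open>F\<close> into \<open>F - c\<close> and the constant \<open>c\<close>:
  domination handles the image of the first, and the image of the second is compared with
  \<open>c\<close> itself. Later \<open>c\<close> is the value of \<open>F\<close> at
  \<open>t\<close>.\<close>

lemma norm_diff_le_dominated:
  fixes L :: "('a::real_normed_vector \<Rightarrow> 'b::real_normed_vector) \<Rightarrow> ('a \<Rightarrow> 'b)"
  assumes lin: "linear_operator X D L" and dom: "dominated_by X D L D' S"
    and UCB: "UCB X \<subseteq> D" and F: "F \<in> UCB X" and t: "t \<in> X"
  shows "norm (L F t - c) \<le> norm (L (\<lambda>u\<in>X. c) t - c) + S (\<lambda>u\<in>X. norm (F u - c)) t"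
proof -
  define G where "G = (\<lambda>u\<in>X. F u - c)"
  have G: "G \<in> D"
    unfolding G_def using diff_const_in_UCB[OF F] UCB by blast
  have C: "(\<lambda>u\<in>X. c) \<in> D"
    using const_in_UCB UCB by blast
  have "L (\<lambda>u\<in>X. G u + (\<lambda>u\<in>X. c) u) = (\<lambda>t\<in>X. L G t + L (\<lambda>u\<in>X. c) t)"
    using lin G C unfolding linear_operator_def by blast
  \<comment> \<open>An equality of functions on the whole type: members of \<open>UCB X\<close> are
    extensional, so both sides also agree outside \<open>X\<close>.\<close>
  moreover have "(\<lambda>u\<in>X. G u + (\<lambda>u\<in>X. c) u) = F"
    using F by (auto simp: G_def UCB_def PiE_def extensional_def)
  ultimately have "L F t = L G t + L (\<lambda>u\<in>X. c) t"
    using t by simp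
  then have "norm (L F t - c) \<le> norm (L (\<lambda>u\<in>X. c) t - c) + norm (L G t)"
    using norm_triangle_ineq[of "L (\<lambda>u\<in>X. c) t - c" "L G t"] by (simp add: algebra_simps)
  moreover have "norm (L G t) \<le> S (\<lambda>u\<in>X. norm (G u)) t"
    using dom G t unfolding dominated_by_def by blast
  moreover have "(\<lambda>u\<in>X. norm (G u)) = (\<lambda>u\<in>X. norm (F u - c))"
    by (auto simp: G_def)
  ultimately show ?thesis
    by simp
qed

text \<open>Positivity makes the argument of \<open>sqrt\<close> nonnegative. In HOL
  \<open>sqrt\<close> is also defined, with negative values, at negative arguments, where squaring
  would not undo it.\<close>

lemma
  assumes "positive_operator X D S" "(\<lambda>u\<in>X. (psi X t u)\<^sup>2) \<in> D" "t \<in> X"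
  shows gam_nonneg: "0 \<le> gam X S t" and gam_power2: "(gam X S t)\<^sup>2 = S (\<lambda>u\<in>X. (psi X t u)\<^sup>2) t"
proof -
  have "0 \<le> S (\<lambda>u\<in>X. (psi X t u)\<^sup>2) t"
    using assms unfolding positive_operator_def by simp
  then show "0 \<le> gam X S t" "(gam X S t)\<^sup>2 = S (\<lambda>u\<in>X. (psi X t u)\<^sup>2) t"
    by (simp_all add: gam_def)
qed

lemma positive_operator_modulus_bound:
  fixes F :: "'a::real_normed_vector \<Rightarrow> 'b::real_normed_vector"
  assumes "convex X" and lin: "linear_operator X D S" and pos: "positive_operator X D S"
    and one: "(\<lambda>u\<in>X. 1) \<in> D" and psi: "(\<lambda>u\<in>X. (psi X t u)\<^sup>2) \<in> D"
    and diff: "(\<lambda>u\<in>X. norm (F u - F t)) \<in> D"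
    and F: "F \<in> UCB X" and t: "t \<in> X" and "0 < \<delta>"
  shows "S (\<lambda>u\<in>X. norm (F u - F t)) t
    \<le> modulus X F \<delta> * (S (\<lambda>u\<in>X. 1) t + (gam X S t)\<^sup>2 / \<delta>\<^sup>2)"
proof -
  \<comment> \<open>The majorant \<open>g\<close> of the quadratic estimate is assembled one
    operation at a time, each restricted to \<open>X\<close> as in \<open>linear_operator\<close>,
    so that its membership in \<open>D\<close> and its image under \<open>S\<close> follow step by
    step.\<close>
  define p where "p = (\<lambda>u\<in>X. (psi X t u)\<^sup>2)"
  define q where "q = (\<lambda>u\<in>X. (1 / \<delta>\<^sup>2) *\<^sub>R p u)"
  define s where "s = (\<lambda>u\<in>X. (\<lambda>u\<in>X. 1) u + q u)"
  define g where "g = (\<lambda>u\<in>X. modulus X F \<delta> *\<^sub>R s u)"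
  have p: "p \<in> D"
    unfolding p_def by (rule psi)
  have q: "q \<in> D"
    using lin p unfolding linear_operator_def map_subspace_def q_def by blast
  have s: "s \<in> D"
    using lin one q unfolding linear_operator_def map_subspace_def s_def by blast
  have g: "g \<in> D"
    using lin s unfolding linear_operator_def map_subspace_def g_def by blast
  have "S q = (\<lambda>t\<in>X. (1 / \<delta>\<^sup>2) *\<^sub>R S p t)"
    using lin p unfolding linear_operator_def q_def by blast
  moreover have "S s = (\<lambda>t\<in>X. S (\<lambda>u\<in>X. 1) t + S q t)"
    using lin one q unfolding linear_operator_def s_def by blast
  moreover have "S g = (\<lambda>t\<in>X. modulus X F \<delta> *\<^sub>R S s t)"
    using lin s unfolding linear_operator_def g_def by blast
  ultimately have Sg: "S g t = modulus X F \<delta> * (S (\<lambda>u\<in>X. 1) t + (gam X S t)\<^sup>2 / \<delta>\<^sup>2)"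
    using t gam_power2[OF pos psi t] by (simp add: p_def)
  have "S (\<lambda>u\<in>X. norm (F u - F t)) t \<le> S g t"
  proof (rule positive_operator_mono[OF lin pos diff g _ t])
    fix u assume "u \<in> X"
    then show "(\<lambda>u\<in>X. norm (F u - F t)) u \<le> g u"
      using norm_diff_le_modulus_quadratic[OF \<open>convex X\<close> F t \<open>u \<in> X\<close> \<open>0 < \<delta>\<close>]
      by (simp add: g_def s_def q_def p_def psi_def)
  qed
  then show ?thesis
    unfolding Sg .
qed

text \<open>Stated for plain reals \<open>x\<close>, \<open>a\<close> and \<open>g\<close>; the
  operators enter only through \<open>bound\<close>. For nonzero \<open>g\<close> the step
  \<open>g\<close> turns the quotient into 1.\<close>

lemma le_modulus_optimal_step:
  fixes F :: "'a::real_normed_vector \<Rightarrow> 'b::real_normed_vector"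
  assumes "X \<noteq> {}" "F \<in> UCB X" "0 \<le> a" "0 \<le> g"
    and bound: "\<And>\<delta>. 0 < \<delta> \<Longrightarrow> x \<le> modulus X F \<delta> * (a + g\<^sup>2 / \<delta>\<^sup>2)"
  shows "x \<le> modulus X F g * (a + 1)"
proof (cases "g = 0")
  case False
  then show ?thesis
    using bound[of g] assms(4) by simp
next
  case True
  \<comment> \<open>Here the claimed bound is 0, since the modulus vanishes at 0. The tolerance
    \<open>e / (a + 1)\<close> below keeps the product with \<open>a\<close> at most
    \<open>e\<close>, also when \<open>a\<close> is 0.\<close>
  have "x \<le> 0 + e" if "0 < e" for e
  proof -
    obtain h where h: "0 < h" "modulus X F h \<le> e / (a + 1)"
      using modulus_arbitrarily_small[OF assms(1,2), of "e / (a + 1)"] \<open>0 < e\<close> assms(3) by auto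
    have "x \<le> modulus X F h * a"
      using bound[OF h(1)] True by simp
    also have "\<dots> \<le> e / (a + 1) * a"
      using h(2) assms(3) by (rule mult_right_mono)
    also have "\<dots> \<le> e"
      using \<open>0 < e\<close> assms(3) by (simp add: field_simps)
    finally show ?thesis by simp
  qed
  then have "x \<le> 0"
    by (rule field_le_epsilon)
  then show ?thesis
    using True modulus_0[OF assms(1,2)] by simp
qed

section \<open>Supremum norms over subsets\<close>

lemma norm_le_sup_norm_on:
  assumes "bounded (F ` K)" "t \<in> K"
  shows "norm (F t) \<le> sup_norm_on K F"
proof -
  have "bdd_above ((\<lambda>u. norm (F u)) ` K)"
    using assms(1) unfolding bounded_iff by (auto intro: bdd_aboveI)
  then show ?thesis
    using assms(2) unfolding sup_norm_on_def by (auto intro: cSUP_upper)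
qed

text \<open>The condition \<open>0 \<le> c\<close> covers the empty \<open>K\<close>, whose supremum
  norm is 0 by definition.\<close>

lemma sup_norm_on_le:
  assumes "0 \<le> c" "\<And>t. t \<in> K \<Longrightarrow> norm (F t) \<le> c"
  shows "sup_norm_on K F \<le> c"
  using assms unfolding sup_norm_on_def by (auto intro: cSUP_least)

lemma sup_norm_on_nonneg:
  assumes "bounded (F ` K)"
  shows "0 \<le> sup_norm_on K F"
proof (cases "K = {}")
  case False
  then obtain t where "t \<in> K" by blast
  show ?thesis
    using norm_le_sup_norm_on[OF assms \<open>t \<in> K\<close>] norm_ge_zero order_trans by blast
qed (simp add: sup_norm_on_def)

text \<open>The modulus is monotone and both factors are nonnegative, so replacing
  \<open>g t\<close> and \<open>a t\<close> by their supremum norms only increases the product. The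
  result no longer depends on \<open>t\<close>, which yields both conclusions.\<close>

lemma sup_norm_on_modulus_bound:
  fixes F :: "'a::real_normed_vector \<Rightarrow> 'b::real_normed_vector"
  assumes "X \<noteq> {}" "F \<in> UCB X" and g: "bounded (g ` K)" and a: "bounded (a ` K)"
    and "\<And>t. t \<in> K \<Longrightarrow> (0::real) \<le> g t" "\<And>t. t \<in> K \<Longrightarrow> (0::real) \<le> a t"
    and bound: "\<And>t. t \<in> K \<Longrightarrow> norm (G t) \<le> modulus X F (g t) * (a t + 1)"
  shows "bounded (G ` K)"
    and "sup_norm_on K G \<le> modulus X F (sup_norm_on K g) * (sup_norm_on K a + 1)"
proof -
  let ?c = "modulus X F (sup_norm_on K g) * (sup_norm_on K a + 1)"
  have w: "0 \<le> modulus X F (sup_norm_on K g)"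
    by (intro modulus_nonneg assms sup_norm_on_nonneg)
  have le: "norm (G t) \<le> ?c" if t: "t \<in> K" for t
  proof -
    have "g t \<le> sup_norm_on K g" "a t \<le> sup_norm_on K a"
      using norm_le_sup_norm_on[OF g t] norm_le_sup_norm_on[OF a t] by simp_all
    then have "modulus X F (g t) * (a t + 1) \<le> ?c"
      using t w assms(5,6) by (intro mult_mono modulus_mono assms(1,2)) auto
    then show ?thesis
      using bound[OF t] by linarith
  qed
  then show "bounded (G ` K)"
    by (auto simp: bounded_iff)
  show "sup_norm_on K G \<le> ?c"
    using w sup_norm_on_nonneg[OF a] le by (intro sup_norm_on_le) auto
qed

text \<open>Of the two forms of the hypothesis on squared distances, for some or for all base
  points, the second is assumed. Boundedness of the error on \<open>K\<close> is part of the
  conclusion, so that its supremum over a nonempty \<open>K\<close> is a genuine one.\<close>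

theorem theorem3p1:
  fixes X :: "'y::real_normed_vector set"
    and L :: "nat \<Rightarrow> ('y \<Rightarrow> 'e::real_normed_vector) \<Rightarrow> ('y \<Rightarrow> 'e)"
    and DL :: "nat \<Rightarrow> ('y \<Rightarrow> 'e) set"
    and S :: "nat \<Rightarrow> ('y \<Rightarrow> real) \<Rightarrow> ('y \<Rightarrow> real)"
    and DS :: "nat \<Rightarrow> ('y \<Rightarrow> real) set"
  assumes "convex X" and "X \<noteq> {}"
    and "\<And>n. n \<ge> 1 \<Longrightarrow> linear_operator X (DL n) (L n)"
    and "\<And>n. n \<ge> 1 \<Longrightarrow> linear_operator X (DS n) (S n)"
    and "\<And>n. n \<ge> 1 \<Longrightarrow> positive_operator X (DS n) (S n)"
    and "\<And>n. n \<ge> 1 \<Longrightarrow> dominated_by X (DL n) (L n) (DS n) (S n)"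
    and "\<And>n. n \<ge> 1 \<Longrightarrow> UCB X \<subseteq> DL n"
    and "\<And>n. n \<ge> 1 \<Longrightarrow> UCB X \<subseteq> DS n"
    and "\<And>n t. n \<ge> 1 \<Longrightarrow> (\<lambda>u\<in>X. (psi X t u)\<^sup>2) \<in> DS n"
  shows "\<forall>n\<ge>1. \<forall>F\<in>UCB X.
    (\<forall>t\<in>X. \<forall>\<delta>>0.
       norm (L n F t - F t)
         \<le> norm (L n (\<lambda>u\<in>X. F t) t - F t) + S n (\<lambda>u\<in>X. norm (F u - F t)) t \<and>
       norm (L n (\<lambda>u\<in>X. F t) t - F t) + S n (\<lambda>u\<in>X. norm (F u - F t)) t
         \<le> norm (L n (\<lambda>u\<in>X. F t) t - F t)
            + modulus X F \<delta> * (S n (\<lambda>u\<in>X. 1) t + (gam X (S n) t)\<^sup>2 / \<delta>\<^sup>2)) \<and>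
    (preserves_constants X (DL n) (L n) \<longrightarrow>
       (\<forall>t\<in>X. \<forall>\<delta>>0.
          norm (L n F t - F t)
            \<le> modulus X F \<delta> * (S n (\<lambda>u\<in>X. 1) t + (gam X (S n) t)\<^sup>2 / \<delta>\<^sup>2)) \<and>
       (\<forall>t\<in>X.
          norm (L n F t - F t)
            \<le> modulus X F (gam X (S n) t) * (S n (\<lambda>u\<in>X. 1) t + 1)) \<and>
       (\<forall>K\<subseteq>X. bounded (gam X (S n) ` K) \<and> bounded (S n (\<lambda>u\<in>X. 1) ` K) \<longrightarrow>
          bounded ((\<lambda>t. L n F t - F t) ` K) \<and>
          sup_norm_on K (\<lambda>t. L n F t - F t)
            \<le> modulus X F (sup_norm_on K (gam X (S n)))
                * (sup_norm_on K (S n (\<lambda>u\<in>X. 1)) + 1)))"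
proof (intro allI impI ballI)
  fix n :: nat and F :: "'y \<Rightarrow> 'e"
  assume n: "1 \<le> n" and F: "F \<in> UCB X"
  note lin = assms(3)[OF n] and linS = assms(4)[OF n] and pos = assms(5)[OF n]
    and dom = assms(6)[OF n] and UCB = assms(7)[OF n] and UCBS = assms(8)[OF n]
    and psi = assms(9)[OF n]
  have one: "(\<lambda>u\<in>X. 1) \<in> DS n"
    using const_in_UCB UCBS by blast
  have one_nonneg: "0 \<le> S n (\<lambda>u\<in>X. 1) t" if "t \<in> X" for t
    using pos one that unfolding positive_operator_def by simp
  \<comment> \<open>Domination itself places the norm of a mapping from \<open>DL n\<close> in
    \<open>DS n\<close>.\<close>
  have diff: "(\<lambda>u\<in>X. norm (F u - F t)) \<in> DS n" for t
  proof -
    have "(\<lambda>u\<in>X. F u - F t) \<in> DL n"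
      using diff_const_in_UCB[OF F] UCB by blast
    then have "(\<lambda>u\<in>X. norm ((\<lambda>u\<in>X. F u - F t) u)) \<in> DS n"
      using dom unfolding dominated_by_def by blast
    also have "(\<lambda>u\<in>X. norm ((\<lambda>u\<in>X. F u - F t) u)) = (\<lambda>u\<in>X. norm (F u - F t))"
      by auto
    finally show ?thesis .
  qed
  have first: "norm (L n F t - F t)
      \<le> norm (L n (\<lambda>u\<in>X. F t) t - F t) + S n (\<lambda>u\<in>X. norm (F u - F t)) t" if "t \<in> X" for t
    by (rule norm_diff_le_dominated[OF lin dom UCB F that])
  have second: "S n (\<lambda>u\<in>X. norm (F u - F t)) t
      \<le> modulus X F \<delta> * (S n (\<lambda>u\<in>X. 1) t + (gam X (S n) t)\<^sup>2 / \<delta>\<^sup>2)"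
    if "t \<in> X" "0 < \<delta>" for t \<delta>
    by (rule positive_operator_modulus_bound[OF assms(1) linS pos one psi diff F that])
  \<comment> \<open>With constants preserved, the first summand of the general estimate is
    0.\<close>
  have const: "norm (L n F t - F t)
      \<le> modulus X F \<delta> * (S n (\<lambda>u\<in>X. 1) t + (gam X (S n) t)\<^sup>2 / \<delta>\<^sup>2)"
    if "preserves_constants X (DL n) (L n)" "t \<in> X" "0 < \<delta>" for t \<delta>
    using first[OF that(2)] second[OF that(2,3)] that(1,2)
    unfolding preserves_constants_def by simp
  have const_gam: "norm (L n F t - F t) \<le> modulus X F (gam X (S n) t) * (S n (\<lambda>u\<in>X. 1) t + 1)"
    if "preserves_constants X (DL n) (L n)" "t \<in> X" for t
    using assms(2) F one_nonneg[OF that(2)] gam_nonneg[OF pos psi that(2)] const[OF that]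
    by (rule le_modulus_optimal_step)
  have const_sup: "bounded ((\<lambda>t. L n F t - F t) ` K) \<and>
      sup_norm_on K (\<lambda>t. L n F t - F t)
        \<le> modulus X F (sup_norm_on K (gam X (S n))) * (sup_norm_on K (S n (\<lambda>u\<in>X. 1)) + 1)"
    if "preserves_constants X (DL n) (L n)" "K \<subseteq> X"
      "bounded (gam X (S n) ` K)" "bounded (S n (\<lambda>u\<in>X. 1) ` K)" for K
    using that(2) one_nonneg gam_nonneg[OF pos psi] const_gam[OF that(1)]
    by (intro conjI sup_norm_on_modulus_bound[OF assms(2) F that(3,4)]) blast+
  show "(\<forall>t\<in>X. \<forall>\<delta>>0.
       norm (L n F t - F t)
         \<le> norm (L n (\<lambda>u\<in>X. F t) t - F t) + S n (\<lambda>u\<in>X. norm (F u - F t)) t \<and>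
       norm (L n (\<lambda>u\<in>X. F t) t - F t) + S n (\<lambda>u\<in>X. norm (F u - F t)) t
         \<le> norm (L n (\<lambda>u\<in>X. F t) t - F t)
            + modulus X F \<delta> * (S n (\<lambda>u\<in>X. 1) t + (gam X (S n) t)\<^sup>2 / \<delta>\<^sup>2)) \<and>
    (preserves_constants X (DL n) (L n) \<longrightarrow>
       (\<forall>t\<in>X. \<forall>\<delta>>0.
          norm (L n F t - F t)
            \<le> modulus X F \<delta> * (S n (\<lambda>u\<in>X. 1) t + (gam X (S n) t)\<^sup>2 / \<delta>\<^sup>2)) \<and>
       (\<forall>t\<in>X.
          norm (L n F t - F t)
            \<le> modulus X F (gam X (S n) t) * (S n (\<lambda>u\<in>X. 1) t + 1)) \<and>
       (\<forall>K\<subseteq>X. bounded (gam X (S n) ` K) \<and> bounded (S n (\<lambda>u\<in>X. 1) ` K) \<longrightarrow>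
          bounded ((\<lambda>t. L n F t - F t) ` K) \<and>
          sup_norm_on K (\<lambda>t. L n F t - F t)
            \<le> modulus X F (sup_norm_on K (gam X (S n)))
                * (sup_norm_on K (S n (\<lambda>u\<in>X. 1)) + 1)))"
    by (intro conjI impI ballI allI)
      (simp_all add: first second const const_gam const_sup)
qed

end
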